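(* Let $f(x),g(x)\in\mathbb{Z}[x]$ be polynomials of positive degree having no common complex root, let $m=\deg(f)$, $n=\deg(g)$, and $d=\gcd(L(f),L(g))$. Let $p,q\in\mathbb{Z}[x]$ be any polynomials with $p(x)f(x)+q(x)g(x)=r(f,g)$, and let $j=\deg(pf)=\deg(qg)$. Then $$R(f,g)\mid d^{j}\, r(f,g)^{\max(m,n)}.$$ Moreover, if both $f$ and $g$ are monic, then $R(f,g)\mid r(f,g)^{\min(m,n)}$.
   Context: $L(h)$ denotes the leading coefficient of $h\in\mathbb{Z}[x]$. $R(f,g)=|\mathrm{Res}(f,g)|$, the absolute value of the resultant of $f$ and $g$. $r(f,g)$ is the smallest positive integer in the set $\{p(x)f(x)+q(x)g(x): p,q\in\mathbb{Z}[x]\}$. *)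

theory Defs
  imports
    "Subresultants.Resultant_Prelim"
    "HOL-Computational_Algebra.Computational_Algebra"
    Complex_Main
begin

definition abs_resultant :: "int poly \<Rightarrow> int poly \<Rightarrow> int" where
  "abs_resultant f g = \<bar>resultant f g\<bar>"

(* Meaningful only if some positive constant lies in the ideal generated by f and g,
   which is the case whenever f and g have no common complex root. *)
definition reduced_resultant :: "int poly \<Rightarrow> int poly \<Rightarrow> int" where
  "reduced_resultant f g =
     (LEAST r. r > 0 \<and> [:r:] \<in> {p * f + q * g |p q. True})"

end

(* If p f + q g = r, then Res(f, q) Res(f, g) = Res(f, q g) = L(f)^j r^m, because q g takes the
   value r at every root of f. Hence R(f, g) divides L(f)^j r^m and, by symmetry, L(g)^j r^n, and
   so it divides their gcd. The evaluation of resultants at roots follows from the Euclidean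
   algorithm: resultants and products over roots obey the same reduction rule. *)
theory Submission
  imports Defs "Subresultants.Subresultant"
begin

section \<open>Factorization over the roots in an algebraically closed field\<close>

lemma alg_closed_proots_factorization:
  fixes f :: "'a :: alg_closed_field poly"
  assumes "f \<noteq> 0"
  shows "size (proots f) = degree f"
    and "f = smult (lead_coeff f) (\<Prod>x\<in>#proots f. [:-x, 1:])"
proof -
  obtain A where A: "size A = degree f" "f = smult (lead_coeff f) (\<Prod>x\<in>#A. [:-x, 1:])"
    using alg_closed_imp_factorization[OF assms] by blast
  \<comment> \<open>Taking roots on both sides of the factorization identifies the anonymous
    multiset \<open>A\<close> with \<open>proots f\<close>.\<close>
  have "proots f = proots (\<Prod>x\<in>#A. [:-x, 1:])"
    using A(2) assms by (metis leading_coeff_0_iff proots_smult)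
  also have "\<dots> = A"
  proof (induction A)
    case (add x A)
    have "(\<Prod>x\<in>#A. [:-x, 1:]) \<noteq> (0 :: 'a poly)"
      by (auto simp: prod_mset_zero_iff)
    then have "proots ([:-x, 1:] * (\<Prod>x\<in>#A. [:-x, 1:])) =
        proots [:-x, 1:] + proots (\<Prod>x\<in>#A. [:-x, 1:])"
      by (intro proots_mult) auto
    also have "\<dots> = add_mset x A"
      by (simp only: proots_linear_factor add.IH minus_minus add_mset_add_single[of x A] add.commute)
    finally show ?case by (simp only: image_mset_add_mset prod_mset.add_mset)
  qed simp
  finally have "proots f = A" .
  with A show "size (proots f) = degree f"
    and "f = smult (lead_coeff f) (\<Prod>x\<in>#proots f. [:-x, 1:])" by simp_all
qed

lemma poly_eq_prod_proots:
  fixes f :: "'a :: alg_closed_field poly"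
  assumes "f \<noteq> 0"
  shows "poly f y = lead_coeff f * (\<Prod>x\<in>#proots f. y - x)"
  by (subst alg_closed_proots_factorization(2)[OF assms]) (simp add: poly_prod_mset)

section \<open>The product over the roots and its symmetry\<close>

text \<open>Poisson's formula for the resultant, roots counted with multiplicity. It depends on
  \<open>g\<close> only through its degree and its values at the roots of \<open>f\<close>, which
  makes reduction modulo \<open>f\<close> easy to follow.\<close>

definition root_product :: "'a :: alg_closed_field poly \<Rightarrow> 'a poly \<Rightarrow> 'a" where
  "root_product f g = lead_coeff f ^ degree g * (\<Prod>x\<in>#proots f. poly g x)"

text \<open>This form treats both polynomials alike up to the sign of each difference; it serves to
  prove the swap rule.\<close>

lemma root_product_double:
  fixes f g :: "'a :: alg_closed_field poly"
  assumes "f \<noteq> 0" "g \<noteq> 0"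
  shows "root_product f g = lead_coeff f ^ degree g * lead_coeff g ^ degree f *
           (\<Prod>x\<in>#proots f. \<Prod>y\<in>#proots g. x - y)"
proof -
  have "poly g = (\<lambda>x. lead_coeff g * (\<Prod>y\<in>#proots g. x - y))"
    using poly_eq_prod_proots[OF assms(2)] by blast
  then have "(\<Prod>x\<in>#proots f. poly g x) =
      (\<Prod>x\<in>#proots f. lead_coeff g * (\<Prod>y\<in>#proots g. x - y))"
    by simp
  also have "\<dots> = lead_coeff g ^ degree f * (\<Prod>x\<in>#proots f. \<Prod>y\<in>#proots g. x - y)"
    by (simp only: prod_mset.distrib prod_mset_constant alg_closed_proots_factorization(1)[OF assms(1)])
  finally show ?thesis by (simp add: root_product_def mult_ac)
qed

lemma root_product_swap:
  fixes f g :: "'a :: alg_closed_field poly"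
  assumes "f \<noteq> 0" "g \<noteq> 0"
  shows "root_product f g = (-1) ^ (degree f * degree g) * root_product g f"
proof -
  have "(\<Prod>x\<in>#proots f. \<Prod>y\<in>#proots g. x - y) =
        (\<Prod>x\<in>#proots f. \<Prod>y\<in>#proots g. (-1) * (y - x))"
    by simp
  also have "\<dots> = (-1) ^ (degree f * degree g) * (\<Prod>x\<in>#proots f. \<Prod>y\<in>#proots g. y - x)"
    by (simp only: prod_mset.distrib prod_mset_constant power_mult[symmetric] mult.commute
        alg_closed_proots_factorization(1)[OF assms(1)] alg_closed_proots_factorization(1)[OF assms(2)])
  also have "(\<Prod>x\<in>#proots f. \<Prod>y\<in>#proots g. y - x) =
      (\<Prod>y\<in>#proots g. \<Prod>x\<in>#proots f. y - x)"
    by (rule prod_mset.swap)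
  finally show ?thesis
    unfolding root_product_double[OF assms] root_product_double[OF assms(2,1)]
    by (simp only: mult_ac)
qed

section \<open>The resultant equals the product over the roots\<close>

text \<open>One Euclidean step, read off from the Brown-Traub identities for subresultants. The
  identity at index 0 requires \<open>degree h > 0\<close>, so constant \<open>h\<close> is treated
  with the one at index \<open>degree h\<close>.\<close>

lemma resultant_mod:
  fixes f g h :: "'a :: idom poly"
  assumes "f + b * g = h" "degree g \<le> degree f" "degree h < degree g"
  shows "resultant f g = (-1) ^ (degree f * degree g) *
           lead_coeff g ^ (degree f - degree h) * resultant g h"
proof (cases "degree h = 0")
  case False
  then have "subresultant 0 f g = smult ((-1) ^ (degree f * degree g) *
      lead_coeff g ^ (degree f - degree h)) (subresultant 0 g h)"
    using BT_lemma_1_12[OF assms(1,2), of 0] assms(3) by simp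
  then show ?thesis by (simp add: subresultant_resultant)
next
  case True
  then obtain c where c: "h = [:c:]" by (metis degree_eq_zeroE)
  have "subresultant (degree h) f g = smult ((-1) ^ (degree f * degree g) *
      lead_coeff g ^ degree f * c ^ (degree g - 1)) h"
    using BT_lemma_1_13[OF assms(1,2)] assms(3) True c by simp
  \<comment> \<open>The missing factor \<open>c\<close> of
    \<open>resultant g [:c:] = c ^ degree g\<close> is supplied by \<open>h\<close> itself;
    \<open>degree g > 0\<close> here.\<close>
  moreover have "c ^ degree g = c * c ^ (degree g - 1)"
    using assms(3) by (cases "degree g") auto
  ultimately show ?thesis using c by (simp add: subresultant_resultant mult_ac)
qed

lemma resultant_eq_root_product:
  fixes f g :: "'a :: alg_closed_field poly"
  assumes "f \<noteq> 0" "g \<noteq> 0"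
  shows "resultant f g = root_product f g"
  using assms
proof (induction "degree f + degree g" arbitrary: f g rule: less_induct)
  case less
  \<comment> \<open>The induction hypothesis is a premise here, so that \<open>main\<close> applies
    to the pair in either order.\<close>
  have main: "resultant f g = root_product f g"
    if le: "degree g \<le> degree f" and nz: "f \<noteq> 0" "g \<noteq> 0"
      and IH: "\<And>f' g' :: 'a poly. degree f' + degree g' < degree f + degree g \<Longrightarrow>
        f' \<noteq> 0 \<Longrightarrow> g' \<noteq> 0 \<Longrightarrow> resultant f' g' = root_product f' g'" for f g :: "'a poly"
  proof (cases "degree g = 0")
    case True
    then obtain c where "g = [:c:]" by (metis degree_eq_zeroE)
    then show ?thesis
      using alg_closed_proots_factorization(1)[OF nz(1)]
      by (simp add: root_product_def prod_mset_constant)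
  next
    case deg: False
    define h where "h = f mod g"
    have eq: "f + (- (f div g)) * g = h"
      by (simp add: h_def minus_div_mult_eq_mod[symmetric])
    have poly_h: "poly f y = poly h y" if "y \<in># proots g" for y
      using that eq nz by (auto simp flip: eq)
    have lt: "degree h < degree g"
      using degree_mod_less[OF nz(2), of f] deg by (auto simp: h_def)
    note res = resultant_mod[OF eq le lt]
    \<comment> \<open>After the swap only the values of \<open>f\<close> at the roots of
      \<open>g\<close> matter, and there \<open>f\<close> agrees with its remainder
      \<open>h\<close>.\<close>
    have swap: "root_product f g = (-1) ^ (degree f * degree g) *
        (lead_coeff g ^ degree f * (\<Prod>y\<in>#proots g. poly h y))"
      unfolding root_product_swap[OF nz] root_product_def[of g f]
      using poly_h by (metis (mono_tags, lifting) image_mset_cong)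
    show ?thesis
    proof (cases "h = 0")
      case True
      \<comment> \<open>If \<open>g\<close> divides \<open>f\<close>, both sides vanish because
        \<open>g\<close> has at least one root.\<close>
      have "(\<Prod>y\<in>#proots g. poly h y) = 0 ^ degree g"
        by (simp only: True poly_0 prod_mset_constant alg_closed_proots_factorization(1)[OF nz(2)])
      then have "root_product f g = 0" using deg unfolding swap by (simp only:) simp
      moreover have "resultant f g = 0" using True deg unfolding res by simp
      ultimately show ?thesis by simp
    next
      case False
      have "resultant g h = root_product g h"
        using IH[of g h] lt le nz False by simp
      \<comment> \<open>The drop in degree from \<open>f\<close> to \<open>h\<close> accounts
        exactly for the extra power of \<open>lead_coeff g\<close> in \<open>res\<close>.\<close>
      moreover have "lead_coeff g ^ degree f =
          lead_coeff g ^ (degree f - degree h) * lead_coeff g ^ degree h"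
        using lt le by (simp flip: power_add)
      ultimately show ?thesis
        unfolding res swap by (simp add: root_product_def mult_ac)
    qed
  qed
  show ?case
  proof (cases "degree g \<le> degree f")
    case True
    then show ?thesis using main less by blast
  next
    case False
    have "resultant g f = root_product g f"
    proof (rule main)
      show "degree f \<le> degree g" using False by simp
      show "resultant f' g' = root_product f' g'"
        if "degree f' + degree g' < degree g + degree f" "f' \<noteq> 0" "g' \<noteq> 0" for f' g' :: "'a poly"
        using that by (intro less.hyps) linarith+
    qed (fact less.prems)+
    then show ?thesis
      by (simp add: resultant_swap[of f g] root_product_swap[OF less.prems])
  qed
qed

section \<open>Integer resultants evaluated through complex roots\<close>

lemma root_product_mult_right:
  assumes "q \<noteq> 0" "g \<noteq> 0"
  shows "root_product f (q * g) = root_product f q * root_product f g"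
  using assms by (simp add: root_product_def degree_mult_eq power_add prod_mset.distrib mult_ac)

text \<open>Multiplicativity is visible on products over roots; it descends from the complex numbers
  because \<open>of_int\<close> is injective and commutes with \<open>resultant\<close>.\<close>

lemma resultant_mult_right:
  fixes f q g :: "int poly"
  assumes "f \<noteq> 0" "q \<noteq> 0" "g \<noteq> 0"
  shows "resultant f (q * g) = resultant f q * resultant f g"
proof -
  let ?c = "map_poly of_int :: int poly \<Rightarrow> complex poly"
  have "resultant (?c f) (?c (q * g)) = resultant (?c f) (?c q) * resultant (?c f) (?c g)"
    using assms by (simp add: of_int_poly_hom.hom_mult resultant_eq_root_product
      root_product_mult_right)
  then have "(of_int (resultant f (q * g)) :: complex) = of_int (resultant f q * resultant f g)"
    by (simp add: of_int_hom.resultant_hom)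
  then show ?thesis by (simp only: of_int_eq_iff)
qed

text \<open>At each complex root of \<open>f\<close> the term \<open>p * f\<close> vanishes, so
  \<open>h\<close> takes the value \<open>c\<close> there; to be used with
  \<open>h = q * g\<close>.\<close>

lemma resultant_eq_const_mod:
  fixes f h p :: "int poly"
  assumes "f \<noteq> 0" "h \<noteq> 0" "p * f + h = [:c:]"
  shows "resultant f h = lead_coeff f ^ degree h * c ^ degree f"
proof -
  let ?c = "map_poly of_int :: int poly \<Rightarrow> complex poly"
  have "?c p * ?c f + ?c h = [:of_int c:]"
    using arg_cong[OF assms(3), of ?c] by (simp add: hom_distribs)
  then have eq: "poly (?c p) y * poly (?c f) y + poly (?c h) y = of_int c" for y
    by (metis poly_add poly_mult poly_const_conv)
  have "poly (?c h) y = of_int c" if "y \<in># proots (?c f)" for y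
  proof -
    have "poly (?c f) y = 0" using that assms(1) by simp
    with eq[of y] show ?thesis by simp
  qed
  then have "(\<Prod>y\<in>#proots (?c f). poly (?c h) y) = (\<Prod>y\<in>#proots (?c f). of_int c)"
    by (metis (mono_tags, lifting) image_mset_cong)
  then have "resultant (?c f) (?c h) = of_int (lead_coeff f ^ degree h * c ^ degree f)"
    using assms(1,2) alg_closed_proots_factorization(1)[of "?c f"]
    by (simp add: resultant_eq_root_product root_product_def prod_mset_constant)
  then show ?thesis by (simp only: of_int_hom.resultant_hom of_int_eq_iff)
qed

text \<open>The cofactor is \<open>resultant f q\<close>.\<close>

lemma resultant_dvd_lead_coeff_power:
  fixes f g p q :: "int poly"
  assumes "f \<noteq> 0" "q * g \<noteq> 0" "p * f + q * g = [:c:]"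
  shows "resultant f g dvd lead_coeff f ^ degree (q * g) * c ^ degree f"
  using assms resultant_mult_right[of f q g] resultant_eq_const_mod[OF assms]
  by (metis dvd_triv_right mult_eq_0_iff)

section \<open>Existence and attainment of the reduced resultant\<close>

text \<open>A nonzero element of least degree in the ideal divides, by pseudo-division, a multiple of
  both polynomials, so its complex roots would be common roots.\<close>
lemma exists_constant_combination:
  fixes f g :: "int poly"
  assumes f: "f \<noteq> 0"
    and no_root: "\<not> (\<exists>z::complex. poly (map_poly of_int f) z = 0 \<and> poly (map_poly of_int g) z = 0)"
  shows "\<exists>p q c. c > 0 \<and> p * f + q * g = [:c:]"
proof -
  define I where "I = {p * f + q * g |p q. True}"
  have fI: "f \<in> I" and gI: "g \<in> I"
    unfolding I_def by (rule CollectI, rule exI[of _ 1], rule exI[of _ 0], simp)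
      (rule CollectI, rule exI[of _ 0], rule exI[of _ 1], simp)
  have minus: "u * a - v * b \<in> I" if ab: "a \<in> I" "b \<in> I" for a b u v
  proof -
    obtain p q p' q' where "a = p * f + q * g" "b = p' * f + q' * g"
      using ab unfolding I_def by blast
    then have "u * a - v * b = (u * p - v * p') * f + (u * q - v * q') * g"
      by (simp add: algebra_simps)
    then show ?thesis by (auto simp: I_def)
  qed
  obtain h where h: "h \<in> I" "h \<noteq> 0" and least: "\<And>k. k \<in> I \<Longrightarrow> k \<noteq> 0 \<Longrightarrow> degree h \<le> degree k"
    using ex_has_least_nat[of "\<lambda>k. k \<in> I \<and> k \<noteq> 0" f degree] fI f by blast
  have dvd: "\<exists>a. a \<noteq> 0 \<and> h dvd smult a k" if k: "k \<in> I" for k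
  proof -
    obtain a u where a: "a \<noteq> 0" "smult a k = h * u + pseudo_mod k h"
      using pseudo_mod(1)[OF h(2)] by blast
    \<comment> \<open>The pseudo-remainder stays in the ideal, so minimality of
      \<open>degree h\<close> forces it to be 0.\<close>
    have "pseudo_mod k h = [:a:] * k - u * h"
      using a(2) by (simp add: algebra_simps)
    then have "pseudo_mod k h \<in> I"
      using minus k h(1) by metis
    then have "pseudo_mod k h = 0"
      using least pseudo_mod(2)[OF h(2), of k] by (metis leD)
    with a show ?thesis by auto
  qed
  have "degree h = 0"
  proof (rule ccontr)
    assume "degree h \<noteq> 0"
    then have "degree (map_poly of_int h :: complex poly) \<noteq> 0" by simp
    then have "\<not> constant (poly (map_poly of_int h :: complex poly))"
      by (simp add: constant_degree)
    then obtain z where z: "poly (map_poly of_int h) z = (0::complex)"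
      using fundamental_theorem_of_algebra by blast
    \<comment> \<open>The nonzero multiplier \<open>a\<close> cancels over the complex numbers, so a
      root of \<open>h\<close> is a root of every element of the ideal.\<close>
    have "poly (map_poly of_int k) z = 0" if k: "k \<in> I" for k
    proof -
      obtain a where "a \<noteq> 0" "h dvd smult a k"
        using dvd[OF k] by blast
      then obtain u where u: "smult a k = h * u" by (elim dvdE)
      have "smult (of_int a) (map_poly of_int k) = map_poly of_int h * (map_poly of_int u :: complex poly)"
        using arg_cong[OF u, of "map_poly (of_int :: int \<Rightarrow> complex)"]
        by (simp add: of_int_poly_hom.hom_mult of_int_hom.map_poly_hom_smult)
      then have "of_int a * poly (map_poly of_int k) z = 0"
        using z by (metis mult_zero_left poly_mult poly_smult)
      with \<open>a \<noteq> 0\<close> show ?thesis by simp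
    qed
    with fI gI no_root show False by blast
  qed
  then obtain c where c: "h = [:c:]" by (metis degree_eq_zeroE)
  obtain p q where pq: "p * f + q * g = [:c:]"
    using h(1) c by (auto simp: I_def)
  show ?thesis
  proof (cases "c > 0")
    case True
    with pq show ?thesis by blast
  next
    case False
    have "(- p) * f + (- q) * g = - [:c:]"
      unfolding pq[symmetric] by simp
    then have "(- p) * f + (- q) * g = [:- c:]" by simp
    moreover have "- c > 0" using False c h(2) by auto
    ultimately show ?thesis by blast
  qed
qed

text \<open>The integers are not well-ordered, so attainment of \<open>LEAST\<close> needs an
  argument: all candidates are positive, hence one minimising \<open>nat c\<close> is the
  least.\<close>

lemma reduced_resultant_combination:
  fixes f g :: "int poly"
  assumes "\<exists>p q c. c > 0 \<and> p * f + q * g = [:c:]"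
  shows "reduced_resultant f g > 0" "\<exists>p q. p * f + q * g = [:reduced_resultant f g:]"
proof -
  define S where "S c \<longleftrightarrow> c > 0 \<and> [:c:] \<in> {p * f + q * g |p q. True}" for c
  have "\<exists>c. S c"
    using assms unfolding S_def by (metis (mono_tags, lifting) mem_Collect_eq)
  then obtain c where c: "S c" "\<And>c'. S c' \<Longrightarrow> nat c \<le> nat c'"
    using ex_has_least_nat[of S _ nat] by blast
  have "reduced_resultant f g = c"
    unfolding reduced_resultant_def S_def[symmetric]
  proof (rule Least_equality)
    show "c \<le> c'" if "S c'" for c'
      using c(2)[OF that] that by (auto simp: S_def nat_le_eq_zle)
  qed (fact c(1))
  with c(1) show "reduced_resultant f g > 0" "\<exists>p q. p * f + q * g = [:reduced_resultant f g:]"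
    by (auto simp: S_def) metis
qed

section \<open>Degrees in the combination and the two divisibilities\<close>

text \<open>A multiple of a nonconstant polynomial is never a nonzero constant, so neither summand
  can vanish; their leading terms must then cancel.\<close>

lemma combination_degree:
  fixes f g p q :: "int poly"
  assumes "degree f > 0" "degree g > 0" "p * f + q * g = [:c:]" "c \<noteq> 0"
  shows "p * f \<noteq> 0" "q * g \<noteq> 0" "degree (q * g) = degree (p * f)"
proof -
  have nonconst: "u * k \<noteq> [:c:]" if "degree k > 0" for u k :: "int poly"
  proof
    assume *: "u * k = [:c:]"
    with assms(4) have "u \<noteq> 0" "k \<noteq> 0" by auto
    then have "degree (u * k) > 0" using that by (simp add: degree_mult_eq)
    with * show False by simp
  qed
  show pf: "p * f \<noteq> 0" and qg: "q * g \<noteq> 0"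
    using nonconst[OF assms(1)] nonconst[OF assms(2)] assms(3) by fastforce+
  have eq: "q * g = [:c:] - p * f" using assms(3) by (simp add: algebra_simps)
  have "degree (p * f) > 0" using pf assms(1) by (simp add: degree_mult_eq)
  then show "degree (q * g) = degree (p * f)"
    unfolding eq diff_conv_add_uminus by (subst degree_add_eq_right) auto
qed

theorem theorem4p1:
  fixes f g :: "int poly" and m n :: nat and d :: int
  assumes "degree f > 0" and "degree g > 0"
    and "\<not> (\<exists>z::complex. poly (map_poly of_int f) z = 0 \<and> poly (map_poly of_int g) z = 0)"
    and "m = degree f" and "n = degree g"
    and "d = gcd (lead_coeff f) (lead_coeff g)"
  shows "(\<forall>(p::int poly) (q::int poly) (j::nat).
            p * f + q * g = [:reduced_resultant f g:] \<longrightarrow> j = degree (p * f) \<longrightarrow>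
              j = degree (q * g) \<and>
              abs_resultant f g dvd d ^ j * reduced_resultant f g ^ max m n) \<and>
         (lead_coeff f = 1 \<longrightarrow> lead_coeff g = 1 \<longrightarrow>
            abs_resultant f g dvd reduced_resultant f g ^ min m n)"
proof -
  let ?r = "reduced_resultant f g"
  let ?R = "abs_resultant f g"
  have f0: "f \<noteq> 0" and g0: "g \<noteq> 0" using assms(1,2) by auto
  have ex: "\<exists>p q c. c > 0 \<and> p * f + q * g = [:c:]"
    using exists_constant_combination[OF f0 assms(3)] .
  have r: "?r \<noteq> 0" using reduced_resultant_combination(1)[OF ex] by simp
  have both: "degree (q * g) = degree (p * f) \<and>
      ?R dvd lead_coeff f ^ degree (p * f) * ?r ^ m \<and>
      ?R dvd lead_coeff g ^ degree (p * f) * ?r ^ n"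
    if pq: "p * f + q * g = [:?r:]" for p q
  proof -
    note deg = combination_degree[OF assms(1,2) pq r]
    have "resultant f g dvd lead_coeff f ^ degree (q * g) * ?r ^ m"
      using resultant_dvd_lead_coeff_power[OF f0 deg(2) pq] assms(4) by simp
    moreover have "resultant g f dvd lead_coeff g ^ degree (p * f) * ?r ^ n"
      using resultant_dvd_lead_coeff_power[OF g0 deg(1)] pq assms(5) by (simp add: add.commute)
    \<comment> \<open>Interchanging the arguments changes only the sign, so both divisibilities
      concern the same number.\<close>
    moreover have "\<bar>resultant g f\<bar> = ?R"
      by (simp add: abs_resultant_def resultant_swap[of f g] abs_mult power_abs)
    ultimately show ?thesis
      using deg(3) by (metis abs_dvd_iff abs_resultant_def)
  qed
  have "?R dvd d ^ j * ?r ^ max m n"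
    if pq: "p * f + q * g = [:?r:]" and j: "j = degree (p * f)" for p q j
  proof -
    \<comment> \<open>Raising both exponents of \<open>?r\<close> to the maximum gives a common
      factor that can be pulled out of the gcd.\<close>
    have "?R dvd lead_coeff f ^ j * ?r ^ max m n" "?R dvd lead_coeff g ^ j * ?r ^ max m n"
      using both[OF pq] j
      by (meson dvd_trans le_imp_power_dvd max.cobounded1 max.cobounded2 mult_dvd_mono dvd_refl)+
    then have "?R dvd gcd (lead_coeff f ^ j * ?r ^ max m n) (lead_coeff g ^ j * ?r ^ max m n)"
      by (rule gcd_greatest)
    also have "\<dots> dvd gcd (lead_coeff f ^ j) (lead_coeff g ^ j) * ?r ^ max m n"
      by (simp add: gcd_mult_right gcd.commute)
    finally show ?thesis
      by (simp add: assms(6) gcd_exp)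
  qed
  \<comment> \<open>With leading coefficients 1, \<open>?R\<close> divides both
    \<open>?r ^ m\<close> and \<open>?r ^ n\<close>, so the smaller exponent can be chosen.\<close>
  moreover have "?R dvd ?r ^ min m n" if "lead_coeff f = 1" "lead_coeff g = 1"
    using reduced_resultant_combination(2)[OF ex] both that
    by (auto simp: min_def)
  moreover have "j = degree (q * g)" if "p * f + q * g = [:?r:]" "j = degree (p * f)" for p q j
    using both[OF that(1)] that(2) by simp
  ultimately show ?thesis by (intro conjI allI impI)
qed

end
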